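(* Let $\mathcal F$ be an analytic filter on $\omega$ (i.e. a filter that is an analytic subset of $\mathcal P(\omega)$). Then the Mathias forcing $\mathbb M_{\mathcal F}$ does not add a dominating real if and only if $\mathcal F$ is $\sigma$-compact (as a subspace of $\mathcal P(\omega)$).
   Context: A filter on $\omega$ is a family $\mathcal F\subset[\omega]^\omega$ (of infinite subsets of $\omega$) that contains all co-finite subsets of $\omega$ and is closed under finite intersections of its elements and under supersets. $\mathcal P(\omega)$ carries the topology of the Cantor space $2^\omega$ via characteristic functions; subsets of it carry the subspace topology. $\mathbb M_{\mathcal F}$ consists of pairs $\langle s,F\rangle$ with $s\in[\omega]^{<\omega}$, $F\in\mathcal F$, and $\max s<\min F$ (no requirement if $s=\emptyset$). A condition $\langle s,F\rangle$ is stronger than $\langle t,G\rangle$ if $F\subset G$, $s$ is an end-extension of $t$, and $s\setminus t\subset G$. A poset $\mathbb P$ adds a dominating real if in some generic extension $V^{\mathbb P}$ there is $x\in\omega^\omega$ such that for every $a\in\omega^\omega\cap V$ we have $a(n)\le x(n)$ for all but finitely many $n$. *)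

theory Defs
  imports "HOL-Analysis.Analysis"
begin

section \<open>Filters on the natural numbers\<close>

definition filter_on_nat :: "nat set set \<Rightarrow> bool" where
  "filter_on_nat \<F> \<longleftrightarrow>
     (\<forall>A\<in>\<F>. infinite A) \<and>
     (\<forall>A. finite (- A) \<longrightarrow> A \<in> \<F>) \<and>
     (\<forall>A\<in>\<F>. \<forall>B\<in>\<F>. A \<inter> B \<in> \<F>) \<and>
     (\<forall>A\<in>\<F>. \<forall>B. A \<subseteq> B \<longrightarrow> B \<in> \<F>)"


section \<open>The Cantor topology on sets of natural numbers\<close>

text \<open>The sets are identified with their characteristic functions, and \<^typ>\<open>nat \<Rightarrow> bool\<close> carries the
  product of the discrete topologies.\<close>

definition cantor_topology :: "nat set topology" where
  "cantor_topology = pullback_topology UNIV (\<lambda>A n. n \<in> A) (euclidean :: (nat \<Rightarrow> bool) topology)"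

text \<open>Analytic sets are the continuous images of the Baire space, that is, of \<^typ>\<open>nat \<Rightarrow> nat\<close> with the
  product of the discrete topologies, together with the empty set. This is the right notion only for
  subsets of a Polish space.\<close>

definition analytic_in :: "'a topology \<Rightarrow> 'a set \<Rightarrow> bool" where
  "analytic_in X A \<longleftrightarrow>
     A = {} \<or> (\<exists>f. continuous_map (euclidean :: (nat \<Rightarrow> nat) topology) X f \<and> range f = A)"

definition sigma_compact_space :: "'a topology \<Rightarrow> bool" where
  "sigma_compact_space X \<longleftrightarrow>
     (\<exists>\<K>. countable \<K> \<and> (\<forall>K\<in>\<K>. compactin X K) \<and> \<Union>\<K> = topspace X)"


section \<open>Forcing and dominating reals\<close>

text \<open>A name for a subset of \<open>\<omega> \<times> \<omega>\<close> is a set of pairs \<open>((n, m), p)\<close> with \<open>p\<close> a condition; the pair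
  \<open>(n, m)\<close> stands for its check name. A generic filter \<open>G\<close> evaluates the name \<open>x\<close> to
  \<open>{(n, m). \<exists>p\<in>G. ((n, m), p) \<in> x}\<close>, and every subset of \<open>\<omega> \<times> \<omega>\<close> in a generic extension is the value
  of such a name.\<close>

type_synonym 'p real_name = "((nat \<times> nat) \<times> 'p) set"

text \<open>A sentence of the forcing language is represented by the predicate on conditions that
  tells which conditions force it. The operations below are the usual clauses of the forcing
  relation. The index type of a quantifier stands for a set of the ground model, such as \<open>\<omega>\<close>,
  which is the same in all extensions, or the set of the ground model reals.\<close>

type_synonym 'p sentence = "'p \<Rightarrow> bool"

text \<open>\<open>p \<preceq> q\<close> means that \<open>p\<close> is stronger than \<open>q\<close>.\<close>

locale forcing_poset =
  fixes P :: "'p set" and le :: "'p \<Rightarrow> 'p \<Rightarrow> bool" (infix "\<preceq>" 50)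
  assumes le_refl: "p \<in> P \<Longrightarrow> p \<preceq> p"
    and le_trans: "\<lbrakk>p \<in> P; q \<in> P; r \<in> P; p \<preceq> q; q \<preceq> r\<rbrakk> \<Longrightarrow> p \<preceq> r"
    and le_antisym: "\<lbrakk>p \<in> P; q \<in> P; p \<preceq> q; q \<preceq> p\<rbrakk> \<Longrightarrow> p = q"
begin

definition f_mem :: "nat \<Rightarrow> nat \<Rightarrow> 'p real_name \<Rightarrow> 'p sentence" where
  "f_mem n m x = (\<lambda>p. \<forall>q\<in>P. q \<preceq> p \<longrightarrow> (\<exists>r\<in>P. r \<preceq> q \<and> (\<exists>t\<in>P. ((n, m), t) \<in> x \<and> r \<preceq> t)))"

text \<open>A statement about the ground model that is absolute.\<close>

definition f_ground :: "bool \<Rightarrow> 'p sentence" where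
  "f_ground Q = (\<lambda>p. Q)"

definition f_and :: "'p sentence \<Rightarrow> 'p sentence \<Rightarrow> 'p sentence" where
  "f_and \<phi> \<psi> = (\<lambda>p. \<phi> p \<and> \<psi> p)"

definition f_imp :: "'p sentence \<Rightarrow> 'p sentence \<Rightarrow> 'p sentence" where
  "f_imp \<phi> \<psi> = (\<lambda>p. \<forall>q\<in>P. q \<preceq> p \<longrightarrow> \<phi> q \<longrightarrow> \<psi> q)"

definition f_all :: "('i \<Rightarrow> 'p sentence) \<Rightarrow> 'p sentence" where
  "f_all \<Phi> = (\<lambda>p. \<forall>i. \<Phi> i p)"

definition f_ex :: "('i \<Rightarrow> 'p sentence) \<Rightarrow> 'p sentence" where
  "f_ex \<Phi> = (\<lambda>p. \<forall>q\<in>P. q \<preceq> p \<longrightarrow> (\<exists>r\<in>P. r \<preceq> q \<and> (\<exists>i. \<Phi> i r)))"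

text \<open>``\<open>x\<close> is the graph of a function from \<open>\<omega>\<close> to \<open>\<omega>\<close>''\<close>

definition f_function :: "'p real_name \<Rightarrow> 'p sentence" where
  "f_function x = f_and
     (f_all (\<lambda>n. f_ex (\<lambda>m. f_mem n m x)))
     (f_all (\<lambda>n. f_all (\<lambda>m. f_all (\<lambda>m'.
        f_imp (f_and (f_mem n m x) (f_mem n m' x)) (f_ground (m = m'))))))"

text \<open>``\<open>a(n) \<le> x(n)\<close> for all but finitely many \<open>n\<close>''\<close>

definition f_dominates :: "'p real_name \<Rightarrow> (nat \<Rightarrow> nat) \<Rightarrow> 'p sentence" where
  "f_dominates x a = f_ex (\<lambda>k. f_all (\<lambda>n. f_imp (f_ground (k \<le> n))
     (f_all (\<lambda>m. f_imp (f_mem n m x) (f_ground (a n \<le> m))))))"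

text \<open>Something holds in some generic extension iff some condition forces it.
  The functions \<open>a :: nat \<Rightarrow> nat\<close> are the reals of the ground model.\<close>

definition adds_dominating_real :: bool where
  "adds_dominating_real \<longleftrightarrow>
     (\<exists>p\<in>P. \<exists>x. x \<subseteq> UNIV \<times> P \<and>
        f_and (f_function x) (f_all (\<lambda>a :: nat \<Rightarrow> nat. f_dominates x a)) p)"

end


section \<open>Mathias forcing\<close>

text \<open>\<^term>\<open>Inf F\<close> is the minimum of a nonempty set of natural numbers.\<close>

definition mathias :: "nat set set \<Rightarrow> (nat set \<times> nat set) set" where
  "mathias \<F> = {(s, F). finite s \<and> F \<in> \<F> \<and> (s \<noteq> {} \<longrightarrow> Max s < Inf F)}"

definition end_extension :: "nat set \<Rightarrow> nat set \<Rightarrow> bool" where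
  "end_extension s t \<longleftrightarrow> t \<subseteq> s \<and> (\<forall>i\<in>s - t. \<forall>j\<in>t. j < i)"

definition mathias_le :: "nat set \<times> nat set \<Rightarrow> nat set \<times> nat set \<Rightarrow> bool" where
  "mathias_le = (\<lambda>(s, F) (t, G). F \<subseteq> G \<and> end_extension s t \<and> s - t \<subseteq> G)"

lemma forcing_poset_mathias: "forcing_poset (mathias \<F>) mathias_le"
proof unfold_locales
  show "mathias_le p p" if "p \<in> mathias \<F>" for p
    by (auto simp: mathias_le_def end_extension_def)
  show "mathias_le p r" if "mathias_le p q" "mathias_le q r" for p q r
    using that unfolding mathias_le_def end_extension_def case_prod_beta by blast
  show "p = q" if "mathias_le p q" "mathias_le q p" for p q
    using that by (auto simp: mathias_le_def end_extension_def prod_eq_iff)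
qed

end

theory Submission
  imports Defs
begin

text \<open>Suppose first that \<open>\<F>\<close> is the union of an increasing sequence of compact sets \<open>K n\<close>. Given a name
  \<open>x\<close> for a function and a possible stem \<open>s\<close> of a condition, every \<open>A \<in> \<F>\<close> includes a finite set \<open>t\<close>
  such that some condition with stem \<open>s \<union> t\<close> decides \<open>x(n)\<close>. Including \<open>t\<close> is an open condition on
  \<open>A\<close>, so finitely many \<open>t\<close> serve all of \<open>K n\<close>, and the values decided with these \<open>t\<close> are bounded. Let
  \<open>a(n)\<close> exceed these bounds for all stems \<open>s \<subseteq> n\<close>. No condition \<open>(s, A)\<close> can force \<open>a \<le> x\<close> from some
  point on: for large \<open>n\<close> it can be extended by such a \<open>t \<subseteq> A\<close>, which makes \<open>x(n) < a(n)\<close>. This is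
  \<open>sigma_compact_no_dominating_real\<close>.

  Conversely, let \<open>\<F>\<close> be analytic and not \<open>\<sigma>\<close>-compact. The argument of Hurewicz' theorem gives a tree
  of points of \<open>\<F>\<close> in which the successors of every node converge to a limit outside \<open>\<F>\<close>. Its branches define a map
  \<open>h\<close> from the Baire space into \<open>\<F>\<close> such that each coordinate \<open>\<alpha> n\<close> is bounded
  while \<open>h \<alpha>\<close> stays close enough to a fixed element of \<open>\<F>\<close>
  (\<open>analytic_not_sigma_compact_locally_bounded\<close>).

  Such a map produces a dominating real (\<open>adds_dominating_real_if_locally_bounded\<close>). For
  \<open>A \<in> \<F>\<close> all supersets of \<open>A - n\<close> belong to \<open>\<F>\<close> and form a compact set, so that already a
  finite part \<open>A \<inter> [n, k)\<close> bounds the coordinate: \<open>\<alpha> n < k\<close> whenever \<open>h \<alpha>\<close> includes that part. The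
  generic set \<open>g\<close> contains finite parts of this kind, and \<open>x(n)\<close> is the least \<open>k\<close> such that
  \<open>g \<inter> [n, k)\<close> bounds the coordinate \<open>n\<close> by \<open>k\<close>. Given a ground model real \<open>a\<close>, the set \<open>g\<close>
  is almost included in \<open>h a \<in> \<F>\<close>. So \<open>h a\<close> includes \<open>g \<inter> [n, x(n))\<close> for large \<open>n\<close>, and
  \<open>a(n) < x(n)\<close>.\<close>


section \<open>The Cantor topology in terms of initial segments\<close>

lemma first_difference:
  assumes "A \<noteq> (B :: nat set)"
  obtains d where "A \<inter> {..<d} = B \<inter> {..<d}" "d \<in> A \<longleftrightarrow> d \<notin> B"
proof -
  obtain d where "(d \<in> A) \<noteq> (d \<in> B)" "\<forall>i<d. (i \<in> A) = (i \<in> B)"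
    using assms exists_least_iff[of "\<lambda>d. (d \<in> A) \<noteq> (d \<in> B)"] by blast
  then show thesis by (intro that[of d]) auto
qed

lemma initial_segment_mem:
  fixes A B :: "nat set"
  assumes "A \<inter> {..<M} = B \<inter> {..<M}" "i < M"
  shows "i \<in> A \<longleftrightarrow> i \<in> B"
  using assms by blast

lemma initial_segment_mono:
  fixes A B :: "nat set"
  assumes "A \<inter> {..<M} = B \<inter> {..<M}" "N \<le> M"
  shows "A \<inter> {..<N} = B \<inter> {..<N}"
  using initial_segment_mem[OF assms(1) less_le_trans[OF _ assms(2)]] by auto

lemma first_difference_unique:
  fixes d e :: nat
  assumes "A \<inter> {..<d} = B \<inter> {..<d}" "d \<in> A \<longleftrightarrow> d \<notin> B"
    and "A \<inter> {..<e} = B \<inter> {..<e}" "e \<in> A \<longleftrightarrow> e \<notin> B"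
  shows "d = e"
proof (rule ccontr)
  assume "d \<noteq> e"
  then have "d \<in> {..<e} \<or> e \<in> {..<d}" by auto
  then show False using assms by blast
qed

text \<open>Stated for arbitrary values because it serves both the Baire space and the Cantor space.\<close>

lemma open_fun_contains_cylinder:
  fixes U :: "(nat \<Rightarrow> 'b::topological_space) set"
  assumes "open U" "x \<in> U"
  shows "\<exists>N. \<forall>w. (\<forall>i<N. w i = x i) \<longrightarrow> w \<in> U"
proof -
  have "openin (product_topology (\<lambda>i. euclidean) UNIV) U"
    using assms(1) by (simp add: euclidean_product_topology)
  from product_topology_open_contains_basis[OF this assms(2)]
  obtain X where X: "x \<in> (\<Pi>\<^sub>E i\<in>UNIV. X i)" "finite {i. X i \<noteq> UNIV}" "(\<Pi>\<^sub>E i\<in>UNIV. X i) \<subseteq> U"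
    by auto
  obtain N where N: "\<And>i. X i \<noteq> UNIV \<Longrightarrow> i < N"
    using X(2) by (metis (mono_tags) finite_nat_set_iff_bounded mem_Collect_eq)
  have "w \<in> U" if "\<forall>i<N. w i = x i" for w
  proof -
    have "w i \<in> X i" for i
      using N[of i] that X(1) by (cases "X i = UNIV") (auto simp: PiE_def Pi_def)
    then show ?thesis using X(3) by (auto simp: PiE_def)
  qed
  then show ?thesis by blast
qed

lemma openin_cantor_iff:
  "openin cantor_topology U \<longleftrightarrow>
     (\<forall>A\<in>U. \<exists>N. \<forall>B. B \<inter> {..<N} = A \<inter> {..<N} \<longrightarrow> B \<in> U)"
proof
  assume "openin cantor_topology U"
  then obtain V where V: "open V" "U = (\<lambda>A n. n \<in> A) -` V"
    by (auto simp: cantor_topology_def openin_pullback_topology)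
  show "\<forall>A\<in>U. \<exists>N. \<forall>B. B \<inter> {..<N} = A \<inter> {..<N} \<longrightarrow> B \<in> U"
  proof
    fix A assume "A \<in> U"
    then have "(\<lambda>n. n \<in> A) \<in> V" using V by auto
    then obtain N where N: "\<And>w. (\<forall>i<N. w i = (i \<in> A)) \<Longrightarrow> w \<in> V"
      using open_fun_contains_cylinder[OF V(1)] by blast
    have "B \<in> U" if "B \<inter> {..<N} = A \<inter> {..<N}" for B
      using N[of "\<lambda>n. n \<in> B"] that V(2) by auto
    then show "\<exists>N. \<forall>B. B \<inter> {..<N} = A \<inter> {..<N} \<longrightarrow> B \<in> U" by blast
  qed
next
  assume R: "\<forall>A\<in>U. \<exists>N. \<forall>B. B \<inter> {..<N} = A \<inter> {..<N} \<longrightarrow> B \<in> U"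
  define V where "V = {w. {n. w n} \<in> U}"
  have "open V"
  proof (subst openin_subopen[where U=euclidean, simplified], intro ballI)
    fix w assume "w \<in> V"
    then have "{n. w n} \<in> U" by (simp add: V_def)
    then obtain N where N: "\<And>B. B \<inter> {..<N} = {n. w n} \<inter> {..<N} \<Longrightarrow> B \<in> U"
      using R by meson
    have "open (\<Inter>i\<in>{..<N}. (\<lambda>v::nat\<Rightarrow>bool. v i) -` {w i})"
      by (intro open_INT ballI open_vimage open_discrete continuous_on_product_coordinates) auto
    moreover have "v \<in> V" if "v \<in> (\<Inter>i\<in>{..<N}. (\<lambda>v. v i) -` {w i})" for v
      unfolding V_def using that by (intro CollectI N) auto
    moreover have "w \<in> (\<Inter>i\<in>{..<N}. (\<lambda>v. v i) -` {w i})" by simp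
    ultimately show "\<exists>T. open T \<and> w \<in> T \<and> T \<subseteq> V" by blast
  qed
  moreover have "U = (\<lambda>A n. n \<in> A) -` V" by (auto simp: V_def)
  ultimately show "openin cantor_topology U"
    by (auto simp: cantor_topology_def openin_pullback_topology)
qed

lemma topspace_cantor [simp]: "topspace cantor_topology = UNIV"
  by (simp add: cantor_topology_def topspace_pullback_topology)

lemma compact_space_cantor: "compact_space cantor_topology"
proof -
  have "compact_space (euclidean :: bool topology)"
    by (simp add: compact_space_def finite_imp_compact)
  then have "compact_space (product_topology (\<lambda>i::nat. euclidean :: bool topology) UNIV)"
    by (simp add: compact_space_product_topology)
  then have "compactin (euclidean :: (nat \<Rightarrow> bool) topology) UNIV"
    by (simp add: euclidean_product_topology compact_space_def)
  moreover have "continuous_map euclidean cantor_topology (\<lambda>w :: nat \<Rightarrow> bool. {n. w n})"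
    unfolding cantor_topology_def
    by (auto simp: continuous_map_pullback' o_def intro!: continuous_map_pullback')
  ultimately have "compactin cantor_topology ((\<lambda>w :: nat \<Rightarrow> bool. {n. w n}) ` UNIV)"
    using image_compactin by blast
  moreover have "range (\<lambda>w :: nat \<Rightarrow> bool. {n. w n}) = UNIV"
    by (auto simp: image_def intro: exI[of _ "\<lambda>n. n \<in> _"])
  ultimately show ?thesis by (simp add: compact_space_def)
qed

lemma compactin_cantor_finite_cover:
  assumes "compactin cantor_topology K"
    and "\<And>t. t \<in> T \<Longrightarrow> openin cantor_topology (U t)"
    and "K \<subseteq> (\<Union>t\<in>T. U t)"
  shows "\<exists>T'. finite T' \<and> T' \<subseteq> T \<and> K \<subseteq> (\<Union>t\<in>T'. U t)"
proof -
  have "\<exists>\<F>. finite \<F> \<and> \<F> \<subseteq> U ` T \<and> K \<subseteq> \<Union> \<F>"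
    using assms by (intro compactinD[OF assms(1)]) auto
  then show ?thesis by (metis finite_subset_image)
qed

text \<open>If no \<open>B\<close> were a cluster point, each \<open>B\<close> would have a neighbourhood that contains \<open>S k\<close> for only
  finitely many \<open>k\<close>, and finitely many of these neighbourhoods cover the compact Cantor space.\<close>

lemma cluster_point:
  fixes S :: "nat \<Rightarrow> nat set"
  shows "\<exists>B. \<forall>N. infinite {k. S k \<inter> {..<N} = B \<inter> {..<N}}"
proof (rule ccontr)
  assume "\<not> ?thesis"
  then obtain M where M: "\<And>B. finite {k. S k \<inter> {..<M B} = B \<inter> {..<M B}}"
    by metis
  have "openin cantor_topology {C. C \<inter> {..<M B} = B \<inter> {..<M B}}" for B
    by (auto simp: openin_cantor_iff intro!: exI[of _ "M B"])
  then obtain T where T: "finite T" "UNIV \<subseteq> (\<Union>B\<in>T. {C. C \<inter> {..<M B} = B \<inter> {..<M B}})"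
    using compactin_cantor_finite_cover[of UNIV UNIV "\<lambda>B. {C. C \<inter> {..<M B} = B \<inter> {..<M B}}"]
      compact_space_cantor by (auto simp: compact_space_def)
  have "(UNIV :: nat set) \<subseteq> (\<Union>B\<in>T. {k. S k \<inter> {..<M B} = B \<inter> {..<M B}})"
    using T(2) by blast
  then have "finite (UNIV :: nat set)"
    using T(1) M by (meson finite_UN_I finite_subset)
  then show False by simp
qed


section \<open>Conditions of Mathias forcing\<close>

lemma filter_infinite: "filter_on_nat \<F> \<Longrightarrow> A \<in> \<F> \<Longrightarrow> infinite A"
  and filter_cofinite: "filter_on_nat \<F> \<Longrightarrow> finite (- A) \<Longrightarrow> A \<in> \<F>"
  and filter_Int: "filter_on_nat \<F> \<Longrightarrow> A \<in> \<F> \<Longrightarrow> B \<in> \<F> \<Longrightarrow> A \<inter> B \<in> \<F>"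
  and filter_mono: "filter_on_nat \<F> \<Longrightarrow> A \<in> \<F> \<Longrightarrow> A \<subseteq> B \<Longrightarrow> B \<in> \<F>"
  unfolding filter_on_nat_def by meson+

lemma filter_UNIV: "filter_on_nat \<F> \<Longrightarrow> UNIV \<in> \<F>"
  by (simp add: filter_cofinite)

lemma filter_Diff_initial:
  assumes "filter_on_nat \<F>" "A \<in> \<F>"
  shows "A - {..<k} \<in> \<F>"
proof -
  have "- {..<k} \<in> \<F>" using assms(1) by (intro filter_cofinite) auto
  then have "A \<inter> - {..<k} \<in> \<F>" by (rule filter_Int[OF assms])
  then show ?thesis by (simp add: Diff_eq)
qed

text \<open>The side condition on \<^const>\<open>Max\<close> and \<^const>\<open>Inf\<close> becomes elementwise because the members of a filter
  are nonempty.\<close>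

lemma mathias_iff:
  assumes "filter_on_nat \<F>"
  shows "(s, A) \<in> mathias \<F> \<longleftrightarrow> finite s \<and> A \<in> \<F> \<and> (\<forall>i\<in>s. \<forall>j\<in>A. i < j)"
proof -
  have "Max s < Inf A \<longleftrightarrow> (\<forall>i\<in>s. \<forall>j\<in>A. i < j)" if "finite s" "s \<noteq> {}" "A \<in> \<F>"
  proof -
    have "A \<noteq> {}" using filter_infinite[OF assms that(3)] by auto
    then have "Inf A \<in> A" "\<forall>j\<in>A. Inf A \<le> j" by (auto intro: Inf_nat_def1 wellorder_Inf_le1)
    then have "Max s < Inf A \<longleftrightarrow> (\<forall>j\<in>A. Max s < j)" by (meson le_less_trans less_le_trans)
    then show ?thesis using Max_less_iff[OF that(1,2)] by blast
  qed
  then show ?thesis unfolding mathias_def by blast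
qed

lemma mathias_le_iff:
  "mathias_le (s, A) (t, B) \<longleftrightarrow>
     A \<subseteq> B \<and> t \<subseteq> s \<and> s - t \<subseteq> B \<and> (\<forall>i\<in>s - t. \<forall>j\<in>t. j < i)"
  by (auto simp: mathias_le_def end_extension_def)


section \<open>No dominating real for filters that are \<open>\<sigma>\<close>-compact\<close>

lemma sigma_compact_increasing:
  assumes "sigma_compact_space (subtopology cantor_topology \<F>)" "\<F> \<noteq> {}"
  shows "\<exists>K. (\<forall>n. compactin cantor_topology (K n)) \<and> mono K \<and> (\<Union>n::nat. K n) = \<F>"
proof -
  obtain \<K> where \<K>: "countable \<K>" "\<And>K. K \<in> \<K> \<Longrightarrow> compactin cantor_topology K" "\<Union>\<K> = \<F>"
    using assms(1) by (auto simp: sigma_compact_space_def compactin_subtopology)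
  then have "\<K> \<noteq> {}" using assms(2) by auto
  then have r: "range (from_nat_into \<K>) = \<K>" using \<K>(1) by (rule range_from_nat_into)
  define K where "K n = (\<Union>i\<le>n. from_nat_into \<K> i)" for n
  have "compactin cantor_topology (K n)" for n
    unfolding K_def using \<K>(2) r by (intro compactin_Union) auto
  moreover have "mono K" unfolding K_def by (intro monoI UN_mono) auto
  moreover have "(\<Union>n. K n) = \<Union>(range (from_nat_into \<K>))" by (auto simp: K_def)
  ultimately show ?thesis unfolding r \<K>(3) by blast
qed

text \<open>The function \<open>a\<close> that beats a name \<open>x\<close> is obtained from two finiteness facts: finitely many
  \<open>t\<close> decide \<open>x(n)\<close> for all \<open>A \<in> K n\<close>, and there are finitely many stems below \<open>n\<close>. Since the sets \<open>K n\<close>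
  increase, each \<open>A \<in> \<F>\<close> is treated by almost all values \<open>a(n)\<close>.\<close>

theorem sigma_compact_no_dominating_real:
  assumes F: "filter_on_nat \<F>" and sc: "sigma_compact_space (subtopology cantor_topology \<F>)"
  shows "\<not> forcing_poset.adds_dominating_real (mathias \<F>) mathias_le"
proof
  interpret forcing_poset "mathias \<F>" mathias_le by (rule forcing_poset_mathias)
  assume "adds_dominating_real"
  then obtain p x where p: "p \<in> mathias \<F>" and fn: "f_function x p"
    and dom: "\<And>a. f_dominates x a p"
    by (auto simp: adds_dominating_real_def f_and_def f_all_def)
  have total: "\<exists>r\<in>mathias \<F>. mathias_le r q \<and> (\<exists>m. f_mem n m x r)"
    if "q \<in> mathias \<F>" "mathias_le q p" for q n
    using fn that by (auto simp: f_function_def f_and_def f_all_def f_ex_def)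
  have mem_mono: "f_mem n m x r"
    if "f_mem n m x q" "mathias_le r q" "r \<in> mathias \<F>" "q \<in> mathias \<F>" for n m r q
    using that le_trans unfolding f_mem_def by blast
  obtain s\<^sub>0 F\<^sub>0 where p_eq: "p = (s\<^sub>0, F\<^sub>0)" by (cases p)
  have "\<F> \<noteq> {}" using filter_UNIV[OF F] by blast
  from sigma_compact_increasing[OF sc this]
  obtain K where K: "\<And>n. compactin cantor_topology (K n)"
    and K_mono: "mono K" and K_Un: "(\<Union>n::nat. K n) = \<F>"
    by blast
  \<comment> \<open>\<open>t\<close> continues the stem \<open>s\<close> so that some condition with stem \<open>s \<union> t\<close> forces \<open>x(n) = m\<close>.\<close>
  define dec where "dec s n m t \<longleftrightarrow> finite t \<and> (\<forall>i\<in>s. \<forall>j\<in>t. i < j) \<and>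
     (\<exists>B. (s \<union> t, B) \<in> mathias \<F> \<and> f_mem n m x (s \<union> t, B))" for s n m t
  define stem where "stem s \<longleftrightarrow> (\<exists>A. (s, A) \<in> mathias \<F> \<and> mathias_le (s, A) p)" for s
  \<comment> \<open>Intersecting with \<open>A\<close> keeps the stem, and any condition below decides \<open>x(n)\<close> after a further extension.\<close>
  have ex_dec: "\<exists>t\<subseteq>A. \<exists>m. dec s n m t" if s: "stem s" and A: "A \<in> \<F>" for s n A
  proof -
    obtain A\<^sub>0 where A0: "(s, A\<^sub>0) \<in> mathias \<F>" "mathias_le (s, A\<^sub>0) p" using s unfolding stem_def by blast
    then have q: "(s, A\<^sub>0 \<inter> A) \<in> mathias \<F>" using F A by (auto simp: mathias_iff filter_Int)
    moreover have "mathias_le (s, A\<^sub>0 \<inter> A) p" using A0(2) by (auto simp: p_eq mathias_le_iff)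
    ultimately obtain u B m where u: "(u, B) \<in> mathias \<F>" "mathias_le (u, B) (s, A\<^sub>0 \<inter> A)" "f_mem n m x (u, B)"
      using total by (metis prod.collapse)
    then have "s \<union> (u - s) = u" by (auto simp: mathias_le_iff)
    then have "dec s n m (u - s)" using u F by (auto simp: dec_def mathias_le_iff mathias_iff)
    moreover have "u - s \<subseteq> A" using u by (auto simp: mathias_le_iff)
    ultimately show ?thesis by blast
  qed
  have ex_bound: "\<exists>b. \<forall>A\<in>K n. \<exists>t\<subseteq>A. \<exists>m<b. dec s n m t" if s: "stem s" for s n
  proof -
    define T where "T = {t. \<exists>m. dec s n m t}"
    have "openin cantor_topology {A. t \<subseteq> A}" if "t \<in> T" for t
    proof -
      have "finite t" using that by (auto simp: T_def dec_def)
      then obtain N where "t \<subseteq> {..<N}" using finite_nat_bounded by blast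
      then show ?thesis by (auto simp: openin_cantor_iff intro!: exI[of _ N])
    qed
    moreover have "K n \<subseteq> (\<Union>t\<in>T. {A. t \<subseteq> A})"
      using ex_dec[OF s] K_Un by (fastforce simp: T_def)
    ultimately obtain T' where T': "finite T'" "T' \<subseteq> T" "K n \<subseteq> (\<Union>t\<in>T'. {A. t \<subseteq> A})"
      using compactin_cantor_finite_cover[OF K, of T "\<lambda>t. {A. t \<subseteq> A}"] by metis
    have "\<forall>t\<in>T'. \<exists>m. dec s n m t" using T'(2) unfolding T_def by blast
    then obtain v where v: "\<And>t. t \<in> T' \<Longrightarrow> dec s n (v t) t" by metis
    have v_less: "v t < Suc (\<Sum>t\<in>T'. v t)" if "t \<in> T'" for t
      using member_le_sum[of t T' v] that T'(1) by auto
    have "\<forall>A\<in>K n. \<exists>t\<subseteq>A. \<exists>m<Suc (\<Sum>t\<in>T'. v t). dec s n m t"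
    proof
      fix A assume "A \<in> K n"
      then obtain t where "t \<in> T'" "t \<subseteq> A" using T'(3) by blast
      then show "\<exists>t\<subseteq>A. \<exists>m<Suc (\<Sum>t\<in>T'. v t). dec s n m t" using v[of t] v_less[of t] by blast
    qed
    then show ?thesis by blast
  qed
  then obtain b where b: "\<And>s n A. stem s \<Longrightarrow> A \<in> K n \<Longrightarrow> \<exists>t\<subseteq>A. \<exists>m<b s n. dec s n m t"
    by metis
  define a where "a n = (\<Sum>s\<in>Pow {..<n}. b s n)" for n
  have ab: "b s n \<le> a n" if "s \<subseteq> {..<n}" for s n
    unfolding a_def using that by (intro member_le_sum) auto
  \<comment> \<open>A condition \<open>(s, A)\<close> that decides the point \<open>k\<close> from which \<open>x\<close> should be above \<open>a\<close>.\<close>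
  obtain s A k where q: "(s, A) \<in> mathias \<F>" "mathias_le (s, A) p" and
    k: "\<And>n m r. k \<le> n \<Longrightarrow> r \<in> mathias \<F> \<Longrightarrow> mathias_le r (s, A) \<Longrightarrow> f_mem n m x r \<Longrightarrow> a n \<le> m"
    using dom[of a] p le_refl
    unfolding f_dominates_def f_ex_def f_all_def f_imp_def f_ground_def
    by (metis prod.collapse)
  have "finite s" "A \<in> \<F>" using q F by (auto simp: mathias_iff)
  obtain l i where l: "s \<subseteq> {..<l}" and i: "A \<in> K i"
    using finite_nat_bounded[OF \<open>finite s\<close>] \<open>A \<in> \<F>\<close> K_Un by blast
  \<comment> \<open>Late enough for the domination, for \<open>s\<close> to be among the stems counted in \<open>a n\<close>, and for \<open>A \<in> K n\<close>.\<close>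
  define n where "n = max k (max l i)"
  have "A \<in> K n" "s \<subseteq> {..<n}" "k \<le> n"
    using monoD[OF K_mono, of i n] i l by (auto simp: n_def le_max_iff_disj)
  moreover have "stem s" using q by (auto simp: stem_def)
  ultimately obtain t m where t: "t \<subseteq> A" "m < b s n" "dec s n m t" using b by blast
  have "m < a n" using t(2) ab[OF \<open>s \<subseteq> {..<n}\<close>] by simp
  obtain B where B: "(s \<union> t, B) \<in> mathias \<F>" "f_mem n m x (s \<union> t, B)"
    using t(3) unfolding dec_def by blast
  have r: "(s \<union> t, A \<inter> B) \<in> mathias \<F>" using B q F by (auto simp: mathias_iff filter_Int)
  have "mathias_le (s \<union> t, A \<inter> B) (s \<union> t, B)" by (auto simp: mathias_le_iff)
  then have "f_mem n m x (s \<union> t, A \<inter> B)" using mem_mono B r by blast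
  moreover have "mathias_le (s \<union> t, A \<inter> B) (s, A)"
    using t by (auto simp: mathias_le_iff dec_def)
  ultimately have "a n \<le> m" using k[OF \<open>k \<le> n\<close> r] by blast
  then show False using \<open>m < a n\<close> by simp
qed


section \<open>A dominating real from a locally bounded indexing\<close>

text \<open>Otherwise there are \<open>\<alpha> k\<close> with \<open>\<alpha> k n \<ge> k\<close> such that \<open>h (\<alpha> k)\<close> includes \<open>A \<inter> [n, k)\<close>. A cluster
  point \<open>B\<close> of the sets \<open>h (\<alpha> k)\<close> includes \<open>A - n\<close>, hence belongs to the filter, and the local bound at
  \<open>B\<close> is violated. Closure of the filter under supersets is essential here; it turns a bound
  near single sets into one that finite subsets of \<open>A\<close> can witness.\<close>

lemma bound_from_finite_subset:
  assumes F: "filter_on_nat \<F>"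
    and h: "\<And>A n. A \<in> \<F> \<Longrightarrow> \<exists>N c. \<forall>\<alpha>. h \<alpha> \<inter> {..<N} = A \<inter> {..<N} \<longrightarrow> \<alpha> n \<le> c"
    and A: "A \<in> \<F>"
  shows "\<exists>k. \<forall>\<alpha> :: nat \<Rightarrow> nat. A \<inter> {n..<k} \<subseteq> h \<alpha> \<longrightarrow> \<alpha> n < k"
proof (rule ccontr)
  assume "\<not> ?thesis"
  then obtain \<alpha> :: "nat \<Rightarrow> nat \<Rightarrow> nat"
    where \<alpha>: "\<And>k. A \<inter> {n..<k} \<subseteq> h (\<alpha> k)" "\<And>k. k \<le> \<alpha> k n"
    by (metis not_less)
  obtain B where B: "\<And>N. infinite {k. h (\<alpha> k) \<inter> {..<N} = B \<inter> {..<N}}"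
    using cluster_point[of "\<lambda>k. h (\<alpha> k)"] by blast
  have late: "\<exists>k\<ge>l. h (\<alpha> k) \<inter> {..<N} = B \<inter> {..<N}" for N l
    using B[of N] by (metis (mono_tags, lifting) infinite_nat_iff_unbounded_le mem_Collect_eq)
  have "A - {..<n} \<subseteq> B"
  proof
    fix j assume j: "j \<in> A - {..<n}"
    obtain k where "k \<ge> Suc j" "h (\<alpha> k) \<inter> {..<Suc j} = B \<inter> {..<Suc j}" using late by blast
    then show "j \<in> B" using \<alpha>(1)[of k] j by auto
  qed
  then have "B \<in> \<F>" by (rule filter_mono[OF F filter_Diff_initial[OF F A]])
  then obtain N c where "\<And>\<alpha>. h \<alpha> \<inter> {..<N} = B \<inter> {..<N} \<Longrightarrow> \<alpha> n \<le> c" using h by blast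
  moreover obtain k where "k \<ge> Suc c" "h (\<alpha> k) \<inter> {..<N} = B \<inter> {..<N}" using late by blast
  ultimately show False using \<alpha>(2)[of k] by fastforce
qed

text \<open>The map \<open>h\<close> witnesses that \<open>\<F>\<close> fails to be a Menger space: for each \<open>n\<close> the
  sets on which \<open>\<alpha> n\<close> is bounded by \<open>c\<close> give an increasing open cover of \<open>\<F>\<close>, and no choice of
  one bound for each \<open>n\<close> covers \<open>\<F>\<close>.\<close>

theorem adds_dominating_real_if_locally_bounded:
  assumes F: "filter_on_nat \<F>"
    and h_in: "\<And>\<alpha> :: nat \<Rightarrow> nat. h \<alpha> \<in> \<F>"
    and h: "\<And>A n. A \<in> \<F> \<Longrightarrow> \<exists>N c. \<forall>\<alpha>. h \<alpha> \<inter> {..<N} = A \<inter> {..<N} \<longrightarrow> \<alpha> n \<le> c"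
  shows "forcing_poset.adds_dominating_real (mathias \<F>) mathias_le"
proof -
  interpret forcing_poset "mathias \<F>" mathias_le by (rule forcing_poset_mathias)
  define bd where "bd n k s \<longleftrightarrow> (\<forall>\<alpha>. s \<inter> {n..<k} \<subseteq> h \<alpha> \<longrightarrow> \<alpha> n < k)" for n k s
  \<comment> \<open>Requiring \<open>A\<close> to start at \<open>k\<close> makes \<open>(s, A)\<close> decide the part of the generic set below \<open>k\<close>,
    so that all stems below it agree with \<open>s\<close> on which \<open>l \<le> k\<close> satisfy \<open>bd n l\<close>.\<close>
  define x where "x = {((n, k), (s, A)) | n k s A.
    (s, A) \<in> mathias \<F> \<and> (\<forall>j\<in>A. k \<le> j) \<and> bd n k s \<and> (\<forall>l<k. \<not> bd n l s)}"
  define p where "p = ({} :: nat set, UNIV :: nat set)"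
  have x_iff: "((n, k), (s, A)) \<in> x \<longleftrightarrow>
    (s, A) \<in> mathias \<F> \<and> (\<forall>j\<in>A. k \<le> j) \<and> bd n k s \<and> (\<forall>l<k. \<not> bd n l s)" for n k s A
    by (auto simp: x_def)
  have bd_cong: "bd n l s \<longleftrightarrow> bd n l u"
    if "mathias_le (u, C) (s, A)" "\<forall>j\<in>A. k \<le> j" "l \<le> k" for n l s u C A k
  proof -
    have "s \<inter> {n..<l} = u \<inter> {n..<l}" using that by (fastforce simp: mathias_le_iff)
    then show ?thesis by (simp add: bd_def)
  qed
  have p: "p \<in> mathias \<F>" by (simp add: p_def mathias_iff[OF F] filter_UNIV[OF F])
  have mem_in: "f_mem n k x t" if "((n, k), t) \<in> x" "t \<in> mathias \<F>" for n k t
    using that le_refl unfolding f_mem_def by blast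
  have mem_mono: "f_mem n m x r"
    if "f_mem n m x q" "mathias_le r q" "r \<in> mathias \<F>" "q \<in> mathias \<F>" for n m r q
    using that le_trans unfolding f_mem_def by blast
  have mem_witness: "\<exists>r\<in>mathias \<F>. mathias_le r q \<and> (\<exists>t\<in>mathias \<F>. ((n, k), t) \<in> x \<and> mathias_le r t)"
    if "f_mem n k x q" "q \<in> mathias \<F>" for n k q
    using that le_refl[OF that(2)] unfolding f_mem_def by blast
  have total: "\<exists>r\<in>mathias \<F>. mathias_le r q \<and> (\<exists>m. f_mem n m x r)" if "q \<in> mathias \<F>" for q n
  proof -
    obtain s A where q: "q = (s, A)" by (cases q)
    then have sA: "finite s" "A \<in> \<F>" "\<And>i j. i \<in> s \<Longrightarrow> j \<in> A \<Longrightarrow> i < j"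
      using that F by (auto simp: mathias_iff)
    obtain k where k: "\<And>\<alpha>. A \<inter> {n..<k} \<subseteq> h \<alpha> \<Longrightarrow> \<alpha> n < k"
      using bound_from_finite_subset[of \<F> h A n] F h sA(2) by blast
    \<comment> \<open>Moving \<open>A \<inter> [0, k)\<close> into the stem gives a bound for the coordinate \<open>n\<close>; the least one is at most \<open>k\<close>.\<close>
    let ?s = "s \<union> (A \<inter> {..<k})" and ?A = "A - {..<k}"
    have "bd n k ?s" using k by (fastforce simp: bd_def)
    define l where "l = (LEAST l. bd n l ?s)"
    have l: "l \<le> k" "bd n l ?s" "\<forall>l'<l. \<not> bd n l' ?s"
      unfolding l_def using \<open>bd n k ?s\<close> by (rule Least_le, rule LeastI) (blast dest: not_less_Least)
    have r: "(?s, ?A) \<in> mathias \<F>"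
      using sA F filter_Diff_initial[OF F sA(2)] by (auto simp: mathias_iff)
    have "((n, l), (?s, ?A)) \<in> x" using r l by (auto simp: x_iff)
    then have "f_mem n l x (?s, ?A)" using mem_in r by blast
    moreover have "mathias_le (?s, ?A) q" using sA by (auto simp: q mathias_le_iff)
    ultimately show ?thesis using r by blast
  qed
  have unique: "m = m'"
    if q: "q \<in> mathias \<F>" and m: "f_mem n m x q" and m': "f_mem n m' x q" for q n m m'
  proof -
    obtain r t where r: "r \<in> mathias \<F>" "mathias_le r q" "((n, m), t) \<in> x" "mathias_le r t" "t \<in> mathias \<F>"
      using mem_witness[OF m q] by blast
    have "f_mem n m' x r" using mem_mono[OF m' r(2,1) q] .
    then obtain r' t' where r': "r' \<in> mathias \<F>" "mathias_le r' r" "((n, m'), t') \<in> x" "mathias_le r' t'"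
      using mem_witness[OF _ r(1)] by blast
    then have "mathias_le r' t" using le_trans[OF r'(1) r(1) r(5) r'(2) r(4)] by blast
    obtain u C s A s' A' where eq: "r' = (u, C)" "t = (s, A)" "t' = (s', A')" by (metis surj_pair)
    have "bd n m u" "\<forall>l<m. \<not> bd n l u"
      using r(3) \<open>mathias_le r' t\<close> bd_cong[of u C s A m _ n] by (auto simp: eq x_iff)
    moreover have "bd n m' u" "\<forall>l<m'. \<not> bd n l u"
      using r'(3,4) bd_cong[of u C s' A' m' _ n] by (auto simp: eq x_iff)
    ultimately show ?thesis by (metis linorder_neqE_nat)
  qed
  have dominates: "\<exists>r\<in>mathias \<F>. mathias_le r q \<and> (\<exists>k. \<forall>n\<ge>k. \<forall>m. \<forall>q'\<in>mathias \<F>.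
      mathias_le q' r \<longrightarrow> f_mem n m x q' \<longrightarrow> a n \<le> m)" if "q \<in> mathias \<F>" for q a
  proof -
    obtain s A where q: "q = (s, A)" by (cases q)
    then have sA: "finite s" "A \<in> \<F>" "\<And>i j. i \<in> s \<Longrightarrow> j \<in> A \<Longrightarrow> i < j"
      using that F by (auto simp: mathias_iff)
    obtain k where k: "s \<subseteq> {..<k}" using finite_nat_bounded[OF sA(1)] by blast
    \<comment> \<open>From now on only elements of \<open>h a\<close> enter the generic set, and all earlier ones are below \<open>k\<close>.\<close>
    let ?r = "(s, A \<inter> h a)"
    have r: "?r \<in> mathias \<F>" using sA F h_in by (auto simp: mathias_iff filter_Int)
    have "a n \<le> m"
      if "n \<ge> k" and q': "q' \<in> mathias \<F>" "mathias_le q' ?r" "f_mem n m x q'" for n m q'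
    proof -
      obtain r' t where r': "r' \<in> mathias \<F>" "mathias_le r' q'" "((n, m), t) \<in> x" "mathias_le r' t"
        using mem_witness[OF q'(3,1)] by blast
      have le: "mathias_le r' ?r" using le_trans[OF r'(1) q'(1) r r'(2) q'(2)] .
      obtain u C v B where eq: "r' = (u, C)" "t = (v, B)" by (metis surj_pair)
      have "v \<subseteq> u" using r'(4) by (simp add: eq mathias_le_iff)
      moreover have "u - s \<subseteq> h a" using le by (auto simp: eq mathias_le_iff)
      moreover have "s \<inter> {n..<m} = {}" using k that(1) by auto
      ultimately have "v \<inter> {n..<m} \<subseteq> h a" by blast
      moreover have "bd n m v" using r'(3) by (simp add: eq x_iff)
      ultimately show ?thesis by (simp add: bd_def less_imp_le)
    qed
    moreover have "mathias_le ?r q" by (auto simp: q mathias_le_iff)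
    ultimately show ?thesis using r by blast
  qed
  have "f_function x p"
    unfolding f_function_def f_and_def f_all_def f_ex_def f_imp_def f_ground_def
    using total unique by blast
  moreover have "f_dominates x a p" for a
    unfolding f_dominates_def f_ex_def f_all_def f_imp_def f_ground_def
  proof (intro ballI impI)
    fix q assume "q \<in> mathias \<F>"
    then obtain r k where r: "r \<in> mathias \<F>" "mathias_le r q"
      and k: "\<forall>n\<ge>k. \<forall>m. \<forall>q'\<in>mathias \<F>. mathias_le q' r \<longrightarrow> f_mem n m x q' \<longrightarrow> a n \<le> m"
      using dominates by blast
    have "\<forall>n. \<forall>q\<^sub>1\<in>mathias \<F>. mathias_le q\<^sub>1 r \<longrightarrow> k \<le> n \<longrightarrow>
        (\<forall>m. \<forall>q\<^sub>2\<in>mathias \<F>. mathias_le q\<^sub>2 q\<^sub>1 \<longrightarrow> f_mem n m x q\<^sub>2 \<longrightarrow> a n \<le> m)"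
      using k le_trans[OF _ _ r(1)] by blast
    with r show "\<exists>r\<in>mathias \<F>. mathias_le r q \<and> (\<exists>k. \<forall>n. \<forall>q\<in>mathias \<F>. mathias_le q r \<longrightarrow> k \<le> n \<longrightarrow>
        (\<forall>m. \<forall>q'\<in>mathias \<F>. mathias_le q' q \<longrightarrow> f_mem n m x q' \<longrightarrow> a n \<le> m))"
      by blast
  qed
  moreover have "x \<subseteq> UNIV \<times> mathias \<F>" by (auto simp: x_def)
  ultimately show ?thesis
    unfolding adds_dominating_real_def f_and_def f_all_def using p by blast
qed


section \<open>Analytic sets that are not \<open>\<sigma>\<close>-compact\<close>

text \<open>For fixed \<open>\<F>\<close> these are the members of the \<open>\<sigma>\<close>-ideal generated by the compact subsets of \<open>\<F>\<close>.\<close>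

definition sigma_bounded :: "nat set set \<Rightarrow> nat set set \<Rightarrow> bool" where
  "sigma_bounded \<F> S \<longleftrightarrow>
     (\<exists>\<K>. countable \<K> \<and> (\<forall>K\<in>\<K>. compactin cantor_topology K \<and> K \<subseteq> \<F>) \<and> S \<subseteq> \<Union>\<K>)"

lemma sigma_bounded_UN:
  assumes "countable I" "\<And>i. i \<in> I \<Longrightarrow> sigma_bounded \<F> (S i)"
  shows "sigma_bounded \<F> (\<Union>i\<in>I. S i)"
proof -
  obtain \<K> where "\<And>i. i \<in> I \<Longrightarrow> countable (\<K> i) \<and>
      (\<forall>K\<in>\<K> i. compactin cantor_topology K \<and> K \<subseteq> \<F>) \<and> S i \<subseteq> \<Union>(\<K> i)"
    using assms(2) unfolding sigma_bounded_def by metis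
  then show ?thesis
    unfolding sigma_bounded_def using assms(1)
    by (intro exI[of _ "\<Union>i\<in>I. \<K> i"]) fastforce
qed

lemma sigma_bounded_Un:
  assumes "sigma_bounded \<F> S" "sigma_bounded \<F> T"
  shows "sigma_bounded \<F> (S \<union> T)"
proof -
  obtain \<K> \<L> where "countable \<K>" "\<forall>K\<in>\<K>. compactin cantor_topology K \<and> K \<subseteq> \<F>" "S \<subseteq> \<Union>\<K>"
    and "countable \<L>" "\<forall>K\<in>\<L>. compactin cantor_topology K \<and> K \<subseteq> \<F>" "T \<subseteq> \<Union>\<L>"
    using assms unfolding sigma_bounded_def by metis
  then show ?thesis
    unfolding sigma_bounded_def by (intro exI[of _ "\<K> \<union> \<L>"]) auto
qed

lemma sigma_bounded_mono: "sigma_bounded \<F> T \<Longrightarrow> S \<subseteq> T \<Longrightarrow> sigma_bounded \<F> S"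
  unfolding sigma_bounded_def by (meson order_trans)

lemma sigma_compact_if_sigma_bounded:
  assumes "sigma_bounded \<F> \<F>"
  shows "sigma_compact_space (subtopology cantor_topology \<F>)"
proof -
  obtain \<K> where "countable \<K>" "\<forall>K\<in>\<K>. compactin cantor_topology K \<and> K \<subseteq> \<F>" "\<F> \<subseteq> \<Union>\<K>"
    using assms by (auto simp: sigma_bounded_def)
  then show ?thesis
    unfolding sigma_compact_space_def
    by (intro exI[of _ \<K>]) (auto simp: compactin_subtopology)
qed

text \<open>Otherwise the closure of \<open>S\<close> is a single compact subset of \<open>\<F>\<close> that covers \<open>S\<close>.\<close>

lemma limit_outside_if_not_sigma_bounded:
  assumes "\<not> sigma_bounded \<F> S"
  shows "\<exists>y. y \<notin> \<F> \<and> (\<forall>N. \<exists>A\<in>S. A \<inter> {..<N} = y \<inter> {..<N})"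
proof (rule ccontr)
  define K where "K = {y. \<forall>N. \<exists>A\<in>S. A \<inter> {..<N} = y \<inter> {..<N}}"
  assume "\<not> ?thesis"
  then have "K \<subseteq> \<F>" unfolding K_def by blast
  have "openin cantor_topology (- K)"
    unfolding openin_cantor_iff
  proof
    fix A assume "A \<in> - K"
    then obtain N where N: "\<forall>B\<in>S. B \<inter> {..<N} \<noteq> A \<inter> {..<N}" by (auto simp: K_def)
    have "C \<in> - K" if "C \<inter> {..<N} = A \<inter> {..<N}" for C
      using N unfolding K_def that[symmetric] by blast
    then show "\<exists>N. \<forall>C. C \<inter> {..<N} = A \<inter> {..<N} \<longrightarrow> C \<in> - K" by blast
  qed
  then have "closedin cantor_topology K" by (simp add: closedin_def Compl_eq_Diff_UNIV)
  then have "compactin cantor_topology K"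
    using closedin_compact_space compact_space_cantor by blast
  moreover have "S \<subseteq> K" by (auto simp: K_def)
  ultimately have "sigma_bounded \<F> S"
    unfolding sigma_bounded_def using \<open>K \<subseteq> \<F>\<close> by (intro exI[of _ "{K}"]) auto
  then show False using assms by simp
qed

text \<open>One step in the construction of the tree. The images of the points \<open>z k\<close> converge to a limit \<open>y\<close> outside \<open>\<F>\<close>, and the
  neighbourhood of \<open>z k\<close> of length \<open>e k\<close> is mapped to sets that first differ from \<open>y\<close> at the same
  place \<open>d k\<close>. Since \<open>d\<close> is injective, a set near a fixed \<open>A \<noteq> y\<close> can come from at most
  one of these neighbourhoods, the one for which \<open>d k\<close> is the first difference of \<open>A\<close> and \<open>y\<close>.\<close>

lemma splitting_sequence:
  fixes f :: "(nat \<Rightarrow> nat) \<Rightarrow> nat set"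
  assumes cont: "\<And>z N. \<exists>e. \<forall>w. (\<forall>i<e. w i = z i) \<longrightarrow> f w \<inter> {..<N} = f z \<inter> {..<N}"
    and f_in: "\<And>z. f z \<in> \<F>"
    and S: "\<not> sigma_bounded \<F> (f ` S)"
  shows "\<exists>y z e d. y \<notin> \<F> \<and> inj d \<and> (\<forall>k::nat. z k \<in> S \<and> n < e k \<and>
     (\<forall>w. (\<forall>i<e k. w i = z k i) \<longrightarrow>
        f w \<inter> {..<d k} = y \<inter> {..<d k} \<and> (d k \<in> f w \<longleftrightarrow> d k \<notin> y)))"
proof -
  obtain y where y: "y \<notin> \<F>" "\<And>N. \<exists>z\<in>S. f z \<inter> {..<N} = y \<inter> {..<N}"
    using limit_outside_if_not_sigma_bounded[OF S] by auto
  have "\<exists>z e d. N \<le> d \<and> z \<in> S \<and> n < e \<and> (\<forall>w. (\<forall>i<e. w i = z i) \<longrightarrow>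
     f w \<inter> {..<d} = y \<inter> {..<d} \<and> (d \<in> f w \<longleftrightarrow> d \<notin> y))" for N
  proof -
    obtain z where z: "z \<in> S" "f z \<inter> {..<N} = y \<inter> {..<N}" using y by blast
    have "f z \<noteq> y" using y(1) f_in by metis
    then obtain d where d: "f z \<inter> {..<d} = y \<inter> {..<d}" "d \<in> f z \<longleftrightarrow> d \<notin> y"
      by (rule first_difference)
    have "N \<le> d" using z(2) d(2) by (metis IntE IntI lessThan_iff not_less)
    obtain e where e: "\<And>w. (\<forall>i<e. w i = z i) \<Longrightarrow> f w \<inter> {..<Suc d} = f z \<inter> {..<Suc d}"
      using cont by blast
    have "f w \<inter> {..<d} = y \<inter> {..<d} \<and> (d \<in> f w \<longleftrightarrow> d \<notin> y)"
      if "\<forall>i<max e (Suc n). w i = z i" for w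
    proof -
      have "f w \<inter> {..<Suc d} = f z \<inter> {..<Suc d}" using that by (intro e) auto
      then show ?thesis using d by (auto simp: lessThan_Suc)
    qed
    then show ?thesis using z(1) \<open>N \<le> d\<close>
      by (intro exI[of _ z] exI[of _ "max e (Suc n)"] exI[of _ d]) auto
  qed
  then obtain z e d where zed: "\<And>N. N \<le> d N \<and> z N \<in> S \<and> n < e N \<and> (\<forall>w. (\<forall>i<e N. w i = z N i) \<longrightarrow>
     f w \<inter> {..<d N} = y \<inter> {..<d N} \<and> (d N \<in> f w \<longleftrightarrow> d N \<notin> y))"
    by metis
  \<comment> \<open>Each point is chosen to agree with \<open>y\<close> beyond the previous first difference.\<close>
  define M where "M = rec_nat 0 (\<lambda>_ N. Suc (d N))"
  have "M (Suc k) = Suc (d (M k))" for k by (simp add: M_def)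
  then have "d (M k) < d (M (Suc k))" for k using zed[of "M (Suc k)"] by simp
  then have "inj (\<lambda>k. d (M k))" by (simp add: strict_mono_Suc_iff strict_mono_imp_inj_on)
  then show ?thesis using y(1) zed
    by (intro exI[of _ y] exI[of _ "\<lambda>k. z (M k)"] exI[of _ "\<lambda>k. e (M k)"] exI[of _ "\<lambda>k. d (M k)"]) auto
qed

text \<open>Write \<open>\<F>\<close> as a continuous image \<open>f\<close> of the Baire space and discard all cylinders with
  \<open>\<sigma>\<close>-bounded image. What remains is a set \<open>W\<close> on which every nonempty relatively open set has an image
  that is not \<open>\<sigma>\<close>-bounded, so splitting steps can be iterated along every \<open>\<alpha>\<close>. The branch along \<open>\<alpha>\<close> has
  a limit \<open>X \<alpha>\<close>, and \<open>h \<alpha> = f (X \<alpha>)\<close>. Since the limits \<open>y\<close> of the steps lie outside \<open>\<F>\<close>, no \<open>A \<in> \<F>\<close> is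
  equal to one of them. Hence an initial segment of \<open>A\<close> determines \<open>\<alpha> 0\<close>, a longer one
  \<open>\<alpha> 1\<close>, and so on, for all \<open>\<alpha>\<close> such that \<open>h \<alpha>\<close> has this initial segment.\<close>

theorem analytic_not_sigma_compact_locally_bounded:
  assumes an: "analytic_in cantor_topology \<F>" and ne: "\<F> \<noteq> {}"
    and nsc: "\<not> sigma_compact_space (subtopology cantor_topology \<F>)"
  obtains h :: "(nat \<Rightarrow> nat) \<Rightarrow> nat set" where "\<And>\<alpha>. h \<alpha> \<in> \<F>"
    "\<And>A n. A \<in> \<F> \<Longrightarrow> \<exists>N c. \<forall>\<alpha>. h \<alpha> \<inter> {..<N} = A \<inter> {..<N} \<longrightarrow> \<alpha> n \<le> c"
proof -
  obtain f :: "(nat \<Rightarrow> nat) \<Rightarrow> nat set"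
    where f: "continuous_map euclidean cantor_topology f" "range f = \<F>"
    using an ne by (auto simp: analytic_in_def)
  have f_in: "f z \<in> \<F>" for z using f(2) by auto
  have cont: "\<exists>e. \<forall>w. (\<forall>i<e. w i = z i) \<longrightarrow> f w \<inter> {..<N} = f z \<inter> {..<N}" for z N
  proof -
    have "openin cantor_topology {B. B \<inter> {..<N} = f z \<inter> {..<N}}"
      by (auto simp: openin_cantor_iff intro!: exI[of _ N])
    from openin_continuous_map_preimage[OF f(1) this]
    have "open {w. f w \<inter> {..<N} = f z \<inter> {..<N}}" by simp
    from open_fun_contains_cylinder[OF this, of z] show ?thesis by simp
  qed
  define cyl where "cyl x n = {w :: nat \<Rightarrow> nat. \<forall>i<n. w i = x i}" for x n
  define W where "W = {x. \<forall>n. \<not> sigma_bounded \<F> (f ` cyl x n)}"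
  \<comment> \<open>There are only countably many cylinders, one for each finite list.\<close>
  have rest: "sigma_bounded \<F> (f ` (- W))"
  proof -
    define I where "I = {l :: nat list. sigma_bounded \<F> (f ` {w. map w [0..<length l] = l})}"
    have "f ` (- W) \<subseteq> (\<Union>l\<in>I. f ` {w. map w [0..<length l] = l})"
    proof
      fix A assume "A \<in> f ` (- W)"
      then obtain x n where x: "A = f x" "sigma_bounded \<F> (f ` cyl x n)" by (auto simp: W_def)
      have "cyl x n = {w. map w [0..<n] = map x [0..<n]}" by (auto simp: cyl_def)
      then have "map x [0..<n] \<in> I" using x(2) by (simp add: I_def)
      then show "A \<in> (\<Union>l\<in>I. f ` {w. map w [0..<length l] = l})"
        using x(1) by (intro UN_I[of "map x [0..<n]"]) auto
    qed
    moreover have "sigma_bounded \<F> (\<Union>l\<in>I. f ` {w. map w [0..<length l] = l})"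
      by (intro sigma_bounded_UN) (auto simp: I_def)
    ultimately show ?thesis using sigma_bounded_mono by blast
  qed
  have big: "\<not> sigma_bounded \<F> (f ` (cyl x n \<inter> W))" if "x \<in> W" for x n
  proof
    assume "sigma_bounded \<F> (f ` (cyl x n \<inter> W))"
    from sigma_bounded_Un[OF this rest] have "sigma_bounded \<F> (f ` cyl x n)"
      by (rule sigma_bounded_mono) auto
    then show False using that by (simp add: W_def)
  qed
  have "\<not> sigma_bounded \<F> (f ` UNIV)"
    using nsc sigma_compact_if_sigma_bounded f(2) by metis
  then have "W \<noteq> {}" using rest by auto
  then obtain x\<^sub>0 where x0: "x\<^sub>0 \<in> W" by blast
  define good where "good x n y z e d \<longleftrightarrow> y \<notin> \<F> \<and> inj d \<and> (\<forall>k::nat. z k \<in> cyl x n \<inter> W \<and> n < e k \<and>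
     (\<forall>w. (\<forall>i<e k. w i = z k i) \<longrightarrow>
        f w \<inter> {..<d k} = y \<inter> {..<d k} \<and> (d k \<in> f w \<longleftrightarrow> d k \<notin> y)))" for x n y z e and d :: "nat \<Rightarrow> nat"
  have "\<exists>y z e d. good x n y z e d" if "x \<in> W" for x n
    unfolding good_def using splitting_sequence[OF cont f_in big[OF that]] .
  then obtain Y Z E D where good: "\<And>x n. x \<in> W \<Longrightarrow> good x n (Y x n) (Z x n) (E x n) (D x n)"
    by metis
  \<comment> \<open>The pair after \<open>j\<close> steps along \<open>\<alpha>\<close> stands for the cylinder of the points that agree with its first
    component up to its second one. It depends only on \<open>\<alpha> 0, \<dots>, \<alpha> (j - 1)\<close>.\<close>
  define node where
    "node \<alpha> = rec_nat (x\<^sub>0, 0) (\<lambda>j (x, n). (Z x n (\<alpha> j), E x n (\<alpha> j)))" for \<alpha> :: "nat \<Rightarrow> nat"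
  define pt where "pt \<alpha> j = fst (node \<alpha> j)" for \<alpha> j
  define len where "len \<alpha> j = snd (node \<alpha> j)" for \<alpha> j
  have node_eq: "node \<alpha> j = (pt \<alpha> j, len \<alpha> j)" for \<alpha> j by (simp add: pt_def len_def)
  have node_Suc: "node \<alpha> (Suc j) = (Z (pt \<alpha> j) (len \<alpha> j) (\<alpha> j), E (pt \<alpha> j) (len \<alpha> j) (\<alpha> j))" for \<alpha> j
    by (simp add: node_def pt_def len_def case_prod_beta)
  have pt_Suc: "pt \<alpha> (Suc j) = Z (pt \<alpha> j) (len \<alpha> j) (\<alpha> j)"
    and len_Suc: "len \<alpha> (Suc j) = E (pt \<alpha> j) (len \<alpha> j) (\<alpha> j)" for \<alpha> j
    using node_Suc[of \<alpha> j] by (simp_all add: node_eq)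
  have pt_W: "pt \<alpha> j \<in> W" for \<alpha> j
  proof (induction j)
    case 0 show ?case using x0 by (simp add: pt_def node_def)
  next
    case (Suc j) then show ?case using good[of "pt \<alpha> j"] by (auto simp: pt_Suc good_def)
  qed
  note good_node = good[OF pt_W, unfolded good_def]
  have len_less: "len \<alpha> j < len \<alpha> (Suc j)" for \<alpha> j
    using good_node by (simp add: len_Suc)
  have len_ge: "j \<le> len \<alpha> j" for \<alpha> j
  proof (induction j)
    case (Suc j) then show ?case using len_less[of \<alpha> j] by simp
  qed simp
  have len_mono: "len \<alpha> j \<le> len \<alpha> j'" if "j \<le> j'" for \<alpha> j j'
    by (rule lift_Suc_mono_le[of "len \<alpha>", OF less_imp_le[OF len_less] that])
  have pt_agree: "pt \<alpha> j' i = pt \<alpha> j i" if "j \<le> j'" "i < len \<alpha> j" for \<alpha> j j' i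
    using that(1)
  proof (induction j' rule: dec_induct)
    case (step k)
    have "pt \<alpha> (Suc k) \<in> cyl (pt \<alpha> k) (len \<alpha> k)" using good_node by (simp add: pt_Suc)
    then show ?case using step that(2) len_mono[of j k \<alpha>] by (auto simp: cyl_def)
  qed simp
  define X where "X \<alpha> i = pt \<alpha> (Suc i) i" for \<alpha> i
  have X_agree: "X \<alpha> i = pt \<alpha> j i" if "i < len \<alpha> j" for \<alpha> i j
  proof (cases "j \<le> Suc i")
    case True then show ?thesis using pt_agree that by (simp add: X_def)
  next
    case False
    then show ?thesis using pt_agree[of "Suc i" j i \<alpha>] len_ge[of "Suc i" \<alpha>] by (simp add: X_def)
  qed
  define h where "h \<alpha> = f (X \<alpha>)" for \<alpha>
  define dif where "dif \<alpha> j = D (pt \<alpha> j) (len \<alpha> j) (\<alpha> j)" for \<alpha> j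
  define lim where "lim \<alpha> j = Y (pt \<alpha> j) (len \<alpha> j)" for \<alpha> j
  have h_dif: "h \<alpha> \<inter> {..<dif \<alpha> j} = lim \<alpha> j \<inter> {..<dif \<alpha> j}"
      "dif \<alpha> j \<in> h \<alpha> \<longleftrightarrow> dif \<alpha> j \<notin> lim \<alpha> j" for \<alpha> j
  proof -
    have "\<forall>i<E (pt \<alpha> j) (len \<alpha> j) (\<alpha> j). X \<alpha> i = Z (pt \<alpha> j) (len \<alpha> j) (\<alpha> j) i"
      using X_agree[of _ \<alpha> "Suc j"] by (simp add: pt_Suc len_Suc)
    then show "h \<alpha> \<inter> {..<dif \<alpha> j} = lim \<alpha> j \<inter> {..<dif \<alpha> j}"
      "dif \<alpha> j \<in> h \<alpha> \<longleftrightarrow> dif \<alpha> j \<notin> lim \<alpha> j"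
      using good_node unfolding h_def dif_def lim_def by blast+
  qed
  \<comment> \<open>If \<open>h \<alpha>\<close> is close to \<open>A\<close>, then both leave the limit of step \<open>j\<close> at the same place.\<close>
  have dif_unique: "dif \<alpha> j = d"
    if lim: "lim \<alpha> j \<inter> {..<d} = A \<inter> {..<d}" "d \<in> lim \<alpha> j \<longleftrightarrow> d \<notin> A"
      and hA: "h \<alpha> \<inter> {..<Suc d} = A \<inter> {..<Suc d}" for \<alpha> j d A
  proof (rule first_difference_unique[OF h_dif])
    show "h \<alpha> \<inter> {..<d} = lim \<alpha> j \<inter> {..<d}"
      using initial_segment_mono[OF hA, of d] lim(1) by simp
    show "d \<in> h \<alpha> \<longleftrightarrow> d \<notin> lim \<alpha> j"
      using initial_segment_mem[OF hA, of d] lim(2) by simp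
  qed
  define agree where "agree A N \<alpha> \<longleftrightarrow> h \<alpha> \<inter> {..<N} = A \<inter> {..<N}" for A N \<alpha>
  have agree_mono: "agree A N \<alpha>" if "agree A M \<alpha>" "N \<le> M" for A N M \<alpha>
    using initial_segment_mono that unfolding agree_def by blast
  \<comment> \<open>The next value of \<open>\<alpha>\<close> can be read off the place where \<open>A\<close> leaves the limit of step \<open>j\<close>.\<close>
  have next_unique: "\<exists>M\<ge>N. \<forall>\<alpha> \<beta>. agree A M \<alpha> \<longrightarrow> agree A M \<beta> \<longrightarrow> \<alpha> j = \<beta> j"
    if A: "A \<in> \<F>" and N: "\<forall>\<alpha> \<beta>. agree A N \<alpha> \<longrightarrow> agree A N \<beta> \<longrightarrow> node \<alpha> j = node \<beta> j" for A N j
  proof (cases "\<exists>\<gamma>. agree A N \<gamma>")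
    case True
    then obtain \<gamma> where \<gamma>: "agree A N \<gamma>" by blast
    have "lim \<gamma> j \<notin> \<F>" using good_node by (simp add: lim_def)
    then have "lim \<gamma> j \<noteq> A" using A by metis
    then obtain d where d: "lim \<gamma> j \<inter> {..<d} = A \<inter> {..<d}" "d \<in> lim \<gamma> j \<longleftrightarrow> d \<notin> A"
      by (rule first_difference)
    have same: "pt \<alpha> j = pt \<gamma> j" "len \<alpha> j = len \<gamma> j" if "agree A (max N (Suc d)) \<alpha>" for \<alpha>
    proof -
      have "agree A N \<alpha>" using agree_mono[OF that] by simp
      then have "node \<alpha> j = node \<gamma> j" using N \<gamma> by blast
      then show "pt \<alpha> j = pt \<gamma> j" "len \<alpha> j = len \<gamma> j" by (simp_all add: pt_def len_def)
    qed
    have "D (pt \<gamma> j) (len \<gamma> j) (\<alpha> j) = d" if "agree A (max N (Suc d)) \<alpha>" for \<alpha>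
    proof -
      have "lim \<alpha> j = lim \<gamma> j" using same[OF that] by (simp add: lim_def)
      moreover have "h \<alpha> \<inter> {..<Suc d} = A \<inter> {..<Suc d}"
        using agree_mono[OF that, of "Suc d"] by (simp add: agree_def)
      ultimately have "dif \<alpha> j = d" using d by (intro dif_unique) auto
      then show ?thesis using same[OF that] by (simp add: dif_def)
    qed
    moreover have "inj (D (pt \<gamma> j) (len \<gamma> j))" using good_node by blast
    ultimately have "\<forall>\<alpha> \<beta>. agree A (max N (Suc d)) \<alpha> \<longrightarrow> agree A (max N (Suc d)) \<beta> \<longrightarrow> \<alpha> j = \<beta> j"
      by (metis injD)
    then show ?thesis by (intro exI[of _ "max N (Suc d)"]) simp
  qed auto
  have node_unique: "\<exists>N. \<forall>\<alpha> \<beta>. agree A N \<alpha> \<longrightarrow> agree A N \<beta> \<longrightarrow> node \<alpha> j = node \<beta> j"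
    if A: "A \<in> \<F>" for A j
  proof (induction j)
    case 0 show ?case by (simp add: node_def)
  next
    case (Suc j)
    then obtain N where N: "\<forall>\<alpha> \<beta>. agree A N \<alpha> \<longrightarrow> agree A N \<beta> \<longrightarrow> node \<alpha> j = node \<beta> j" by blast
    obtain M where M: "M \<ge> N" "\<forall>\<alpha> \<beta>. agree A M \<alpha> \<longrightarrow> agree A M \<beta> \<longrightarrow> \<alpha> j = \<beta> j"
      using next_unique[OF A N] by blast
    have "node \<alpha> (Suc j) = node \<beta> (Suc j)" if "agree A M \<alpha>" "agree A M \<beta>" for \<alpha> \<beta>
    proof -
      have "node \<alpha> j = node \<beta> j" using N agree_mono[OF _ M(1)] that by blast
      moreover have "\<alpha> j = \<beta> j" using M that by blast
      ultimately show ?thesis by (simp add: node_def)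
    qed
    then show ?case by blast
  qed
  show thesis
  proof (rule that[of h])
    show "h \<alpha> \<in> \<F>" for \<alpha> using f_in by (simp add: h_def)
    fix A n assume A: "A \<in> \<F>"
    obtain N where "\<forall>\<alpha> \<beta>. agree A N \<alpha> \<longrightarrow> agree A N \<beta> \<longrightarrow> node \<alpha> n = node \<beta> n"
      using node_unique[OF A] by blast
    from next_unique[OF A this]
    obtain M where M: "\<And>\<alpha> \<beta>. agree A M \<alpha> \<Longrightarrow> agree A M \<beta> \<Longrightarrow> \<alpha> n = \<beta> n" by blast
    have "\<exists>c. \<forall>\<alpha>. agree A M \<alpha> \<longrightarrow> \<alpha> n \<le> c" using M by (metis order_refl)
    then show "\<exists>N c. \<forall>\<alpha>. h \<alpha> \<inter> {..<N} = A \<inter> {..<N} \<longrightarrow> \<alpha> n \<le> c"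
      unfolding agree_def by blast
  qed
qed

theorem corollary1p2:
  fixes \<F> :: "nat set set"
  assumes "filter_on_nat \<F>"
    and "analytic_in cantor_topology \<F>"
  shows "\<not> forcing_poset.adds_dominating_real (mathias \<F>) mathias_le
           \<longleftrightarrow> sigma_compact_space (subtopology cantor_topology \<F>)"
proof
  have "\<F> \<noteq> {}" using filter_UNIV[OF assms(1)] by blast
  then have "forcing_poset.adds_dominating_real (mathias \<F>) mathias_le"
    if "\<not> sigma_compact_space (subtopology cantor_topology \<F>)"
    using analytic_not_sigma_compact_locally_bounded[OF assms(2) _ that]
      adds_dominating_real_if_locally_bounded[OF assms(1)] by metis
  then show "\<not> forcing_poset.adds_dominating_real (mathias \<F>) mathias_le
      \<Longrightarrow> sigma_compact_space (subtopology cantor_topology \<F>)" by blast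
qed (rule sigma_compact_no_dominating_real[OF assms(1)])

end
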